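(* Let $\Omega\subset\mathbb{R}^d$ be a bounded measurable set with non-empty interior. Then the singular representation $\xi_s$ of $L^1(\Omega)$ is discontinuous, as a map from its domain (with the subspace topology of Baire space) to $L^1(\Omega)$ with the norm topology.
   Context: $\Sigma=\{0,1\}$; Baire space is the set of functions $\Sigma^*\to\Sigma^*$ with the product topology ($\Sigma^*$ discrete). $|a|$ is the length of a string; $1^n$ the unary string of length $n$. Fix a polynomial-time bijective pairing $\langle\cdot,\cdot\rangle$ on $\Sigma^*$ (iterated for tuples) and an encoding $a\mapsto[\![a]\!]$ of dyadic rationals by strings; dyadic vectors are encoded by tuples. A string function $\varphi$ is length-monotone if $|a|\le|b|\Rightarrow|\varphi(a)|\le|\varphi(b)|$; then $|\varphi|:\mathbb{N}\to\mathbb{N}$ is given by $|\varphi|(|a|)=|\varphi(a)|$. For strings $a,b$ encoding dyadic vectors, $[a,b]$ is the smallest axis-parallel box with corners $[\![a]\!],[\![b]\!]$. $\tilde f$ is the extension of $f$ to $\mathbb{R}^d$ by zero. A function $\mu:\mathbb{N}\to\mathbb{N}$ is a singularity modulus of $f\in L^1(\Omega)$ if for each $i$, with $f_i(t):=\int_{\mathbb{R}^{d-1}}\tilde f(x_1,\dots,x_{i-1},t,x_{i+1},\dots,x_d)\,d(x_j)_{j\ne i}$, one has for all $n$ and $x,y\in\mathbb{R}$: $|x-y|\le 2^{-\mu(n)}\Rightarrow|\int_{[x,y]}f_i\,d\lambda|<2^{-n}$. The singular representation $\xi_s$ of $L^1(\Omega)$: a length-monotone $\varphi$ is a name of $f$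 iff for all strings $a,b$ encoding dyadic vectors and all $n$, $\left|\int_{[a,b]}\tilde f\,d\lambda-[\![\varphi(\langle a,b,1^n\rangle)]\!]\right|<2^{-n}$, and $|\varphi|$ is a singularity modulus of $f$.
   Formalization: The encoding of dyadic rationals is assumed to give any finitely many dyadics codes of one common, arbitrarily large length (as with leading zeros); for arbitrary encodings length-monotone names may exist only for the zero function, and the claim can fail. *)

theory Defs
  imports "HOL-Analysis.Analysis"
begin

type_synonym bstring = "bool list"

definition unary :: "nat \<Rightarrow> bstring" where
  "unary n = replicate n True"

fun tuple :: "(bstring \<Rightarrow> bstring \<Rightarrow> bstring) \<Rightarrow> bstring list \<Rightarrow> bstring" where
  "tuple pr [] = []"
| "tuple pr [a] = a"
| "tuple pr (a # b # as) = pr a (tuple pr (b # as))"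

(* The library set dyadics contains only the nonnegative dyadic rationals. *)
definition dyadic_rats :: "real set" where
  "dyadic_rats = {of_int m / 2 ^ k | m k. True}"

(* dec is the partial map sending a string a to the dyadic rational [[a]] it encodes.
   The values of a length-monotone string function on strings of equal length have equal
   length, so names are built from codes of one prescribed length.  Hence an encoding must
   provide codes of a common, arbitrarily large length for any finitely many dyadic
   rationals, as the usual encodings do by allowing leading zeros; without this,
   nonzero functions need not have names in the singular representation. *)
definition dyadic_encoding :: "(bstring \<rightharpoonup> real) \<Rightarrow> bool" where
  "dyadic_encoding dec \<longleftrightarrow>
     ran dec = dyadic_rats \<and>
     (\<forall>Q N. finite Q \<and> Q \<subseteq> dyadic_rats \<longrightarrow>
        (\<exists>n\<ge>N. \<forall>q\<in>Q. \<exists>a. length a = n \<and> dec a = Some q))"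

definition encodes_vec ::
    "(bstring \<Rightarrow> bstring \<Rightarrow> bstring) \<Rightarrow> (bstring \<rightharpoonup> real) \<Rightarrow> bstring
      \<Rightarrow> real ^ 'n::{finite,linorder} \<Rightarrow> bool" where
  "encodes_vec pr dec a v \<longleftrightarrow>
     (\<exists>c. a = tuple pr (map c (sorted_list_of_set (UNIV :: 'n set))) \<and>
          (\<forall>i. dec (c i) = Some (v $ i)))"

definition length_monotone :: "(bstring \<Rightarrow> bstring) \<Rightarrow> bool" where
  "length_monotone \<phi> \<longleftrightarrow>
     (\<forall>a b. length a \<le> length b \<longrightarrow> length (\<phi> a) \<le> length (\<phi> b))"

(* The function |phi| on natural numbers.  For length-monotone phi the choice of the
   argument of length n is immaterial, see length_monotone_fun_size. *)
definition fun_size :: "(bstring \<Rightarrow> bstring) \<Rightarrow> nat \<Rightarrow> nat" where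
  "fun_size \<phi> n = length (\<phi> (unary n))"

definition baire_space :: "(bstring \<Rightarrow> bstring) topology" where
  "baire_space = product_topology (\<lambda>_. discrete_topology UNIV) UNIV"

definition corner_box :: "real ^ 'n \<Rightarrow> real ^ 'n \<Rightarrow> (real ^ 'n) set" where
  "corner_box u v = cbox (\<chi> i. min (u $ i) (v $ i)) (\<chi> i. max (u $ i) (v $ i))"

definition zero_ext :: "'a set \<Rightarrow> ('a \<Rightarrow> real) \<Rightarrow> 'a \<Rightarrow> real" where
  "zero_ext \<Omega> f x = (if x \<in> \<Omega> then f x else 0)"

(* The measure is Lebesgue measure on the coordinates other than i; the completion makes
   almost every slice of a Lebesgue measurable function measurable.  In dimension one it is
   the unit mass on a one-point space, so that the marginal is the extended function itself. *)
definition marginal :: "(real ^ 'n) set \<Rightarrow> (real ^ 'n \<Rightarrow> real) \<Rightarrow> 'n \<Rightarrow> real \<Rightarrow> real" where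
  "marginal \<Omega> f i t =
     (LINT y | completion (Pi\<^sub>M (UNIV - {i}) (\<lambda>_. lborel)).
        zero_ext \<Omega> f (\<chi> j. if j = i then t else y j))"

definition singularity_modulus ::
    "(real ^ 'n) set \<Rightarrow> (real ^ 'n \<Rightarrow> real) \<Rightarrow> (nat \<Rightarrow> nat) \<Rightarrow> bool" where
  "singularity_modulus \<Omega> f \<mu> \<longleftrightarrow>
     (\<forall>i n x y. \<bar>x - y\<bar> \<le> 1 / 2 ^ \<mu> n \<longrightarrow>
        \<bar>LINT t : {min x y..max x y} | lebesgue. marginal \<Omega> f i t\<bar> < 1 / 2 ^ n)"

definition L1_funs :: "(real ^ 'n) set \<Rightarrow> (real ^ 'n \<Rightarrow> real) set" where
  "L1_funs \<Omega> = {f. integrable (lebesgue_on \<Omega>) f}"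

definition L1_rel :: "(real ^ 'n) set \<Rightarrow> ((real ^ 'n \<Rightarrow> real) \<times> (real ^ 'n \<Rightarrow> real)) set" where
  "L1_rel \<Omega> = {(f, g). f \<in> L1_funs \<Omega> \<and> g \<in> L1_funs \<Omega> \<and> (AE x in lebesgue_on \<Omega>. f x = g x)}"

definition L1 :: "(real ^ 'n) set \<Rightarrow> (real ^ 'n \<Rightarrow> real) set set" where
  "L1 \<Omega> = L1_funs \<Omega> // L1_rel \<Omega>"

(* The distance induced by the norm, computed on representatives. *)
definition L1_dist ::
    "(real ^ 'n) set \<Rightarrow> (real ^ 'n \<Rightarrow> real) set \<Rightarrow> (real ^ 'n \<Rightarrow> real) set \<Rightarrow> real" where
  "L1_dist \<Omega> F G = (LINT x | lebesgue_on \<Omega>. \<bar>(SOME f. f \<in> F) x - (SOME g. g \<in> G) x\<bar>)"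

definition L1_topology :: "(real ^ 'n) set \<Rightarrow> (real ^ 'n \<Rightarrow> real) set topology" where
  "L1_topology \<Omega> = Metric_space.mtopology (L1 \<Omega>) (L1_dist \<Omega>)"

definition is_singular_name ::
    "(bstring \<Rightarrow> bstring \<Rightarrow> bstring) \<Rightarrow> (bstring \<rightharpoonup> real) \<Rightarrow> (real ^ 'n::{finite,linorder}) set
      \<Rightarrow> (bstring \<Rightarrow> bstring) \<Rightarrow> (real ^ 'n::{finite,linorder} \<Rightarrow> real) \<Rightarrow> bool" where
  "is_singular_name pr dec \<Omega> \<phi> f \<longleftrightarrow>
     length_monotone \<phi> \<and>
     (\<forall>a b u v n. encodes_vec pr dec a u \<and> encodes_vec pr dec b v \<longrightarrow>
        (\<exists>q. dec (\<phi> (tuple pr [a, b, unary n])) = Some q \<and>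
             \<bar>(LINT x : corner_box u v | lebesgue. zero_ext \<Omega> f x) - q\<bar> < 1 / 2 ^ n)) \<and>
     singularity_modulus \<Omega> f (fun_size \<phi>)"

definition xi_s_dom ::
    "(bstring \<Rightarrow> bstring \<Rightarrow> bstring) \<Rightarrow> (bstring \<rightharpoonup> real) \<Rightarrow> (real ^ 'n::{finite,linorder}) set
      \<Rightarrow> (bstring \<Rightarrow> bstring) set" where
  "xi_s_dom pr dec \<Omega> = {\<phi>. \<exists>F\<in>L1 \<Omega>. \<exists>f\<in>F. is_singular_name pr dec \<Omega> \<phi> f}"

(* The element named by phi is unique, see ex1_singular_named. *)
definition xi_s ::
    "(bstring \<Rightarrow> bstring \<Rightarrow> bstring) \<Rightarrow> (bstring \<rightharpoonup> real) \<Rightarrow> (real ^ 'n::{finite,linorder}) set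
      \<Rightarrow> (bstring \<Rightarrow> bstring) \<Rightarrow> (real ^ 'n::{finite,linorder} \<Rightarrow> real) set" where
  "xi_s pr dec \<Omega> \<phi> = (THE F. F \<in> L1 \<Omega> \<and> (\<exists>f\<in>F. is_singular_name pr dec \<Omega> \<phi> f))"


lemma length_monotone_fun_size:
  assumes "length_monotone \<phi>"
  shows "fun_size \<phi> (length a) = length (\<phi> a)"
  using assms unfolding length_monotone_def fun_size_def unary_def
  by (metis le_antisym length_replicate order_refl)

(* A standard encoding: sign, exponent of the denominator in unary, end marker, and the
   numerator in binary, most significant bit first, leading zeros allowed. *)

definition bin_val :: "bstring \<Rightarrow> nat" where
  "bin_val w = foldl (\<lambda>m b. 2 * m + of_bool b) 0 w"

definition std_dec :: "bstring \<rightharpoonup> real" where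
  "std_dec a =
     (case a of
        [] \<Rightarrow> None
      | s # r \<Rightarrow>
         (case dropWhile id r of
            [] \<Rightarrow> None
          | _ # w \<Rightarrow>
              Some ((if s then - 1 else 1) * real (bin_val w) / 2 ^ length (takeWhile id r))))"

lemma std_dec_code:
  "std_dec (s # replicate k True @ False # w) =
     Some ((if s then - 1 else 1) * real (bin_val w) / 2 ^ k)"
proof -
  have "dropWhile id (replicate k True @ False # w) = False # w"
    by (induction k) auto
  moreover have "takeWhile id (replicate k True @ False # w) = replicate k True"
    by (induction k) auto
  ultimately show ?thesis by (simp add: std_dec_def)
qed

lemma bin_val_pad: "bin_val (replicate j False @ w) = bin_val w"
proof -
  have "foldl (\<lambda>m b. 2 * m + of_bool b) (0::nat) (replicate j False) = 0"
    by (induction j) auto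
  then show ?thesis by (simp add: bin_val_def)
qed

lemma bin_val_surj: "\<exists>w. bin_val w = m"
proof (induction m rule: less_induct)
  case (less m)
  show ?case
  proof (cases "m = 0")
    case True
    then show ?thesis by (intro exI[of _ "[]"]) (simp add: bin_val_def)
  next
    case False
    then obtain w where "bin_val w = m div 2" using less[of "m div 2"] by auto
    then have "bin_val (w @ [odd m]) = m" by (simp add: bin_val_def)
    then show ?thesis by blast
  qed
qed

lemma std_dec_padded:
  assumes "q \<in> dyadic_rats"
  shows "\<exists>N. \<forall>n\<ge>N. \<exists>a. length a = n \<and> std_dec a = Some q"
proof -
  obtain m k where q: "q = of_int m / 2 ^ k" using assms by (auto simp: dyadic_rats_def)
  obtain w where w: "bin_val w = nat \<bar>m\<bar>" using bin_val_surj by blast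
  show ?thesis
  proof (intro exI[of _ "k + length w + 2"] allI impI)
    fix n assume n: "n \<ge> k + length w + 2"
    let ?a = "(m < 0) # replicate k True @ False # (replicate (n - (k + length w + 2)) False @ w)"
    have "std_dec ?a = Some q"
      unfolding std_dec_code bin_val_pad w q by auto
    moreover have "length ?a = n" using n by simp
    ultimately show "\<exists>a. length a = n \<and> std_dec a = Some q" by blast
  qed
qed

lemma dyadic_encoding_std_dec: "dyadic_encoding std_dec"
  unfolding dyadic_encoding_def
proof (intro conjI allI impI)
  show "ran std_dec = dyadic_rats"
  proof
    show "ran std_dec \<subseteq> dyadic_rats"
    proof
      fix q assume "q \<in> ran std_dec"
      then obtain a where "std_dec a = Some q" by (auto simp: ran_def)
      then obtain s w k where q: "q = (if s then - 1 else 1) * real (bin_val w) / 2 ^ k"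
        by (auto simp only: std_dec_def option.inject option.distinct split: list.splits)
      have "q = of_int ((if s then - 1 else 1) * int (bin_val w)) / 2 ^ k"
        by (simp add: q)
      then show "q \<in> dyadic_rats" unfolding dyadic_rats_def by blast
    qed
    show "dyadic_rats \<subseteq> ran std_dec"
      using std_dec_padded by (fastforce simp: ran_def)
  qed
next
  fix Q :: "real set" and N :: nat assume Q: "finite Q \<and> Q \<subseteq> dyadic_rats"
  then obtain M where M: "\<And>q n. q \<in> Q \<Longrightarrow> n \<ge> M q \<Longrightarrow> \<exists>a. length a = n \<and> std_dec a = Some q"
    using std_dec_padded by (metis subsetD)
  have "M q \<le> sum M Q" if "q \<in> Q" for q
    using Q that by (simp add: member_le_sum)
  then show "\<exists>n\<ge>N. \<forall>q\<in>Q. \<exists>a. length a = n \<and> std_dec a = Some q"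
    using M by (intro exI[of _ "N + sum M Q"]) (auto simp: trans_le_add2)
qed

lemma equiv_L1_rel: "equiv (L1_funs \<Omega>) (L1_rel \<Omega>)"
proof (rule equivI)
  show "refl_on (L1_funs \<Omega>) (L1_rel \<Omega>)" by (auto simp: refl_on_def L1_rel_def)
  show "L1_rel \<Omega> \<subseteq> L1_funs \<Omega> \<times> L1_funs \<Omega>" by (auto simp: L1_rel_def)
  show "sym (L1_rel \<Omega>)" by (auto simp: sym_def L1_rel_def elim: eventually_mono)
  show "trans (L1_rel \<Omega>)"
    unfolding trans_def L1_rel_def by (auto elim: eventually_elim2)
qed

lemma L1_rep:
  assumes "F \<in> L1 \<Omega>"
  shows "(SOME f. f \<in> F) \<in> F" "(SOME f. f \<in> F) \<in> L1_funs \<Omega>"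
proof -
  have "F \<noteq> {}" using assms equiv_L1_rel in_quotient_imp_non_empty unfolding L1_def by blast
  then show *: "(SOME f. f \<in> F) \<in> F" by (simp add: some_in_eq)
  show "(SOME f. f \<in> F) \<in> L1_funs \<Omega>"
    using * assms in_quotient_imp_subset[OF equiv_L1_rel] unfolding L1_def by blast
qed

lemma Metric_space_L1: "Metric_space (L1 \<Omega>) (L1_dist \<Omega>)"
proof
  fix F G
  show "0 \<le> L1_dist \<Omega> F G" by (simp add: L1_dist_def)
  show "L1_dist \<Omega> F G = L1_dist \<Omega> G F" by (simp add: L1_dist_def abs_minus_commute)
next
  fix F G assume F: "F \<in> L1 \<Omega>" and G: "G \<in> L1 \<Omega>"
  let ?f = "SOME f. f \<in> F" and ?g = "SOME f. f \<in> G"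
  have i: "integrable (lebesgue_on \<Omega>) (\<lambda>x. \<bar>?f x - ?g x\<bar>)"
    using L1_rep(2)[OF F] L1_rep(2)[OF G] by (auto simp: L1_funs_def)
  have "L1_dist \<Omega> F G = 0 \<longleftrightarrow> (AE x in lebesgue_on \<Omega>. \<bar>?f x - ?g x\<bar> = 0)"
    unfolding L1_dist_def by (rule integral_nonneg_eq_0_iff_AE[OF i]) auto
  also have "\<dots> \<longleftrightarrow> (?f, ?g) \<in> L1_rel \<Omega>"
    using L1_rep(2)[OF F] L1_rep(2)[OF G] by (auto simp: L1_rel_def)
  also have "\<dots> \<longleftrightarrow> F = G"
    using quotient_eq_iff[OF equiv_L1_rel, of F \<Omega> G] F G L1_rep(1)[OF F] L1_rep(1)[OF G]
    unfolding L1_def by blast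
  finally show "L1_dist \<Omega> F G = 0 \<longleftrightarrow> F = G" .
next
  fix F G H assume "F \<in> L1 \<Omega>" "G \<in> L1 \<Omega>" "H \<in> L1 \<Omega>"
  then have i: "integrable (lebesgue_on \<Omega>) (SOME f. f \<in> F)"
    "integrable (lebesgue_on \<Omega>) (SOME f. f \<in> G)" "integrable (lebesgue_on \<Omega>) (SOME f. f \<in> H)"
    using L1_rep(2) by (auto simp: L1_funs_def)
  show "L1_dist \<Omega> F H \<le> L1_dist \<Omega> F G + L1_dist \<Omega> G H"
  proof -
    have "(LINT x | lebesgue_on \<Omega>. \<bar>(SOME f. f \<in> F) x - (SOME f. f \<in> H) x\<bar>)
        \<le> (LINT x | lebesgue_on \<Omega>. \<bar>(SOME f. f \<in> F) x - (SOME f. f \<in> G) x\<bar>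
              + \<bar>(SOME f. f \<in> G) x - (SOME f. f \<in> H) x\<bar>)"
      using i by (intro integral_mono) auto
    also have "\<dots> = L1_dist \<Omega> F G + L1_dist \<Omega> G H"
      unfolding L1_dist_def using i by (intro Bochner_Integration.integral_add) auto
    finally show ?thesis unfolding L1_dist_def .
  qed
qed

(* The box integrals of an integrable function determine it almost everywhere, so that the
   singular representation is single-valued. *)

lemma dyadic_box_limit:
  fixes l u :: "real ^ 'n"
  assumes ne: "box l u \<noteq> {}"
  obtains p q :: "nat \<Rightarrow> real ^ 'n" where
    "\<And>k i. p k $ i \<in> dyadic_rats" "\<And>k i. q k $ i \<in> dyadic_rats"
    "\<And>x. (\<lambda>k. indicator (corner_box (p k) (q k)) x :: real) \<longlonglongrightarrow> indicator (box l u) x"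
proof -
  define p :: "nat \<Rightarrow> real ^ 'n" where "p k = (\<chi> i. of_int (\<lfloor>2 ^ k * l $ i\<rfloor> + 1) / 2 ^ k)" for k
  define q :: "nat \<Rightarrow> real ^ 'n" where "q k = (\<chi> i. of_int (\<lceil>2 ^ k * u $ i\<rceil> - 1) / 2 ^ k)" for k
  have lu: "l $ i < u $ i" for i
    using ne by (auto simp: interval_ne_empty_cart)
  have p_gt: "l $ i < p k $ i" for k i
  proof -
    have "2 ^ k * l $ i < of_int (\<lfloor>2 ^ k * l $ i\<rfloor> + 1)" by linarith
    then show ?thesis by (simp add: p_def field_simps)
  qed
  have p_le: "p k $ i \<le> l $ i + (1/2) ^ k" for k i
  proof -
    have "of_int (\<lfloor>2 ^ k * l $ i\<rfloor> + 1) \<le> 2 ^ k * l $ i + 1" by linarith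
    then have "of_int (\<lfloor>2 ^ k * l $ i\<rfloor> + 1) / 2 ^ k \<le> (2 ^ k * l $ i + 1) / 2 ^ k"
      by (rule divide_right_mono) simp
    then show ?thesis by (simp add: p_def add_divide_distrib power_divide)
  qed
  have q_lt: "q k $ i < u $ i" for k i
  proof -
    have "of_int (\<lceil>2 ^ k * u $ i\<rceil> - 1) < 2 ^ k * u $ i" by linarith
    then show ?thesis by (simp add: q_def field_simps)
  qed
  have q_ge: "u $ i - (1/2) ^ k \<le> q k $ i" for k i
  proof -
    have "2 ^ k * u $ i - 1 \<le> of_int (\<lceil>2 ^ k * u $ i\<rceil> - 1)" by linarith
    then have "(2 ^ k * u $ i - 1) / 2 ^ k \<le> of_int (\<lceil>2 ^ k * u $ i\<rceil> - 1) / 2 ^ k"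
      by (rule divide_right_mono) simp
    then show ?thesis by (simp add: q_def diff_divide_distrib power_divide)
  qed
  have small: "\<forall>\<^sub>F k in sequentially. (1/2::real) ^ k < e" if "e > 0" for e
    using that LIMSEQ_power_zero[of "1/2::real"] by (intro order_tendstoD(2)) auto
  have "\<forall>\<^sub>F k in sequentially. \<forall>i. (1/2) ^ k < (u $ i - l $ i) / 2"
    using lu by (intro eventually_all_finite allI small) (simp add: finite_code)
  then have ordered: "\<forall>\<^sub>F k in sequentially. \<forall>i. p k $ i \<le> q k $ i"
  proof (rule eventually_mono, intro allI)
    fix k i assume "\<forall>i. (1/2) ^ k < (u $ i - l $ i) / 2"
    then have e: "(1/2) ^ k < (u $ i - l $ i) / 2" by blast
    define e :: real where "e = (1/2) ^ k"
    show "p k $ i \<le> q k $ i"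
      using e p_le[of k i] q_ge[of i k] unfolding e_def[symmetric] by (simp add: field_simps)
  qed
  show thesis
  proof
    show "p k $ i \<in> dyadic_rats" for k i
      unfolding p_def dyadic_rats_def vec_lambda_beta by blast
    show "q k $ i \<in> dyadic_rats" for k i
      unfolding q_def dyadic_rats_def vec_lambda_beta by blast
    fix x
    have "\<forall>\<^sub>F k in sequentially. x \<in> corner_box (p k) (q k) \<longleftrightarrow> x \<in> box l u"
    proof (cases "x \<in> box l u")
      case True
      then have "l $ i < x $ i" "x $ i < u $ i" for i by (auto simp: mem_box_cart)
      then have "\<forall>\<^sub>F k in sequentially. \<forall>i. (1/2) ^ k < min (x $ i - l $ i) (u $ i - x $ i)"
        by (intro eventually_all_finite allI small) (simp add: finite_code)
      then show ?thesis
      proof (rule eventually_mono)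
        fix k assume *: "\<forall>i. (1/2) ^ k < min (x $ i - l $ i) (u $ i - x $ i)"
        have "p k $ i \<le> x $ i \<and> x $ i \<le> q k $ i" for i
          using *[rule_format, of i] p_le[of k i] q_ge[of i k] by auto
        then show "x \<in> corner_box (p k) (q k) \<longleftrightarrow> x \<in> box l u"
          using True by (simp add: corner_box_def mem_box_cart min.coboundedI1 max.coboundedI2)
      qed
    next
      case False
      show ?thesis using ordered
      proof (rule eventually_mono)
        fix k assume *: "\<forall>i. p k $ i \<le> q k $ i"
        have "x \<in> box l u" if "x \<in> corner_box (p k) (q k)"
        proof -
          have "l $ i < x $ i \<and> x $ i < u $ i" for i
          proof -
            have "p k $ i \<le> x $ i \<and> x $ i \<le> q k $ i"
              using that *[rule_format, of i] by (auto simp: corner_box_def mem_box_cart min_absorb1 max_absorb2 *)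
            then show ?thesis using p_gt[of i k] q_lt[of k i] by linarith
          qed
          then show ?thesis by (simp add: mem_box_cart)
        qed
        then show "x \<in> corner_box (p k) (q k) \<longleftrightarrow> x \<in> box l u" using False by blast
      qed
    qed
    then show "(\<lambda>k. indicator (corner_box (p k) (q k)) x :: real) \<longlonglongrightarrow> indicator (box l u) x"
      by (intro tendsto_eventually) (auto elim!: eventually_mono simp: indicator_def)
  qed
qed

lemma integrable_zero_on_dyadic_boxes:
  fixes h :: "real ^ 'n \<Rightarrow> real"
  assumes h: "integrable lebesgue h"
    and z: "\<And>u v. (\<And>i. u $ i \<in> dyadic_rats) \<Longrightarrow> (\<And>i. v $ i \<in> dyadic_rats) \<Longrightarrow>
              (LINT x : corner_box u v | lebesgue. h x) = 0"
  shows "AE x in lebesgue. h x = 0"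
proof -
  have int: "integrable lebesgue (\<lambda>x. indicator A x *\<^sub>R h x)" if "A \<in> sets lebesgue" for A
    using integrable_mult_indicator[OF that h] .
  have box0: "(LINT x : box l u | lebesgue. h x) = 0" for l u
  proof (cases "box l u = {}")
    case True
    then show ?thesis by (simp add: set_lebesgue_integral_def)
  next
    case False
    obtain p q :: "nat \<Rightarrow> real ^ 'n" where d: "\<And>k i. p k $ i \<in> dyadic_rats" "\<And>k i. q k $ i \<in> dyadic_rats"
      and lim: "\<And>x. (\<lambda>k. indicator (corner_box (p k) (q k)) x :: real) \<longlonglongrightarrow> indicator (box l u) x"
      by (rule dyadic_box_limit[OF False]) blast
    have "(\<lambda>k. LINT x | lebesgue. indicator (corner_box (p k) (q k)) x *\<^sub>R h x)
             \<longlonglongrightarrow> (LINT x | lebesgue. indicator (box l u) x *\<^sub>R h x)"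
    proof (rule integral_dominated_convergence[where w="\<lambda>x. \<bar>h x\<bar>"])
      show "(\<lambda>x. indicator (box l u) x *\<^sub>R h x) \<in> borel_measurable lebesgue"
        by (rule borel_measurable_integrable, rule int) simp
      show "(\<lambda>x. indicator (corner_box (p k) (q k)) x *\<^sub>R h x) \<in> borel_measurable lebesgue" for k
        by (rule borel_measurable_integrable, rule int) (simp add: corner_box_def)
      show "AE x in lebesgue. (\<lambda>k. indicator (corner_box (p k) (q k)) x *\<^sub>R h x)
              \<longlonglongrightarrow> indicator (box l u) x *\<^sub>R h x"
        by (intro AE_I2 tendsto_scaleR lim tendsto_const)
      show "AE x in lebesgue. norm (indicator (corner_box (p k) (q k)) x *\<^sub>R h x) \<le> \<bar>h x\<bar>" for k
        by (auto simp: indicator_def)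
    qed (use h in auto)
    moreover have "(LINT x | lebesgue. indicator (corner_box (p k) (q k)) x *\<^sub>R h x) = 0" for k
      using z[OF d(1) d(2)] by (simp add: set_lebesgue_integral_def)
    ultimately show ?thesis
      by (simp add: set_lebesgue_integral_def LIMSEQ_const_iff)
  qed
  obtain h' where h': "h' \<in> borel_measurable lborel" "AE x in lborel. h x = h' x"
    using completion_ex_borel_measurable_real[of h lborel] h by auto
  have ae: "AE x in lebesgue. h x = h' x" using h'(2) by (rule AE_completion)
  have h'm: "h' \<in> borel_measurable lebesgue" using h'(1) by (rule measurable_completion)
  have int': "integrable lborel h'"
    using integrable_cong_AE[OF borel_measurable_integrable[OF h] h'm ae] h h'(1)
    by (simp add: integrable_completion)
  have box1: "(LINT x : box l u | lborel. h' x) = 0" for l u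
  proof -
    have "(LINT x : box l u | lborel. h' x) = (LINT x : box l u | lebesgue. h' x)"
      unfolding set_lebesgue_integral_def using h'(1) by (intro integral_completion[symmetric]) simp
    also have "\<dots> = (LINT x : box l u | lebesgue. h x)"
      unfolding set_lebesgue_integral_def
    proof (rule integral_cong_AE)
      show "(\<lambda>x. indicator (box l u) x *\<^sub>R h x) \<in> borel_measurable lebesgue"
        by (rule borel_measurable_integrable, rule int) simp
      show "(\<lambda>x. indicator (box l u) x *\<^sub>R h' x) \<in> borel_measurable lebesgue"
        using h'(1) by (intro measurable_completion) simp
      show "AE x in lebesgue. indicator (box l u) x *\<^sub>R h' x = indicator (box l u) x *\<^sub>R h x"
        using ae by (rule eventually_mono) simp
    qed
    finally show ?thesis by (simp add: box0)
  qed
  have si: "set_integrable lborel A h'" if "A \<in> sets borel" for A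
    unfolding set_integrable_def using that int' by (intro integrable_mult_indicator) auto
  let ?E = "range (\<lambda>(a, b). box a b :: (real ^ 'n) set)"
  have E: "sets (borel :: (real ^ 'n) measure) = sigma_sets UNIV ?E"
    by (simp add: borel_eq_box)
  have total: "(LINT x | lborel. h' x) = 0"
  proof -
    let ?A = "\<lambda>n::nat. box (- (real n *\<^sub>R One)) (real n *\<^sub>R One) :: (real ^ 'n) set"
    have "(\<lambda>n. LINT x : ?A n | lborel. h' x) \<longlonglongrightarrow> (LINT x : (\<Union>n. ?A n) | lborel. h' x)"
    proof (rule set_integral_cont_up)
      show "incseq ?A"
        unfolding incseq_def
      proof (intro allI impI subsetI)
        fix m n :: nat and x :: "real ^ 'n" assume mn: "m \<le> n" and x: "x \<in> ?A m"
        have one: "One \<bullet> b = 1" if "b \<in> Basis" for b :: "real ^ 'n"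
          using that by (simp add: inner_sum_left inner_Basis)
        have "- real n < x \<bullet> b \<and> x \<bullet> b < real n" if b: "b \<in> Basis" for b
        proof -
          have "- real m < x \<bullet> b \<and> x \<bullet> b < real m"
            using x b one[OF b] by (simp add: mem_box)
          moreover have "real m \<le> real n" using mn by simp
          ultimately show ?thesis by linarith
        qed
        then show "x \<in> ?A n" by (simp add: mem_box one)
      qed
      show "set_integrable lborel (\<Union>n. ?A n) h'" by (rule si) simp
    qed simp
    then have "(LINT x : UNIV | lborel. h' x) = 0"
      unfolding UN_box_eq_UNIV box1 by (simp add: LIMSEQ_const_iff)
    then show ?thesis by (simp add: set_lebesgue_integral_def)
  qed
  have "(LINT x : A | lborel. h' x) = 0" if "A \<in> sets borel" for A
  proof -
    have "Int_stable ?E" by (auto simp: Int_stable_def box_Int_box)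
    moreover have "?E \<subseteq> Pow UNIV" by simp
    moreover have "A \<in> sigma_sets UNIV ?E" using that E by simp
    ultimately show ?thesis
    proof (induction rule: sigma_sets_induct_disjoint)
      case (basic A)
      then show ?case using box1 by auto
    next
      case empty
      show ?case by (simp add: set_lebesgue_integral_def)
    next
      case (compl A)
      then have A: "A \<in> sets borel" using E by simp
      have "(LINT x : UNIV - A | lborel. h' x) + (LINT x : A | lborel. h' x) = (LINT x : (UNIV - A) \<union> A | lborel. h' x)"
        using A by (intro set_integral_Un[symmetric] si) auto
      then show ?case using compl total by (simp add: set_lebesgue_integral_def)
    next
      case (union A)
      have A: "A i \<in> sets borel" for i using union(2) E by auto
      have "(LINT x : (\<Union>i. A i) | lborel. h' x) = (\<Sum>i. LINT x : A i | lborel. h' x)"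
        using union(1) A by (intro lebesgue_integral_countable_add si) (auto simp: disjoint_family_on_def)
      then show ?case using union(3) by simp
    qed
  qed
  then have "AE x in lborel. h' x = 0"
    using int' by (intro sigma_finite_measure.density_zero[OF sigma_finite_lborel]) auto
  then have "AE x in lebesgue. h' x = 0" by (rule AE_completion)
  with ae show ?thesis by (rule eventually_elim2) simp
qed

lemma ex_encodes_vec:
  assumes "dyadic_encoding dec" "\<And>i. v $ i \<in> dyadic_rats"
  shows "\<exists>a. encodes_vec pr dec a v"
proof -
  have "\<forall>i. \<exists>c. dec c = Some (v $ i)"
    using assms unfolding dyadic_encoding_def ran_def by blast
  then show ?thesis unfolding encodes_vec_def by metis
qed

lemma integrable_zero_ext:
  assumes "\<Omega> \<in> sets lebesgue" "f \<in> L1_funs \<Omega>"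
  shows "integrable lebesgue (zero_ext \<Omega> f)"
proof -
  have "integrable lebesgue (\<lambda>x. indicator \<Omega> x *\<^sub>R f x)"
    using assms by (simp add: L1_funs_def integrable_restrict_space)
  moreover have "(\<lambda>x. indicator \<Omega> x *\<^sub>R f x) = zero_ext \<Omega> f"
    by (auto simp: zero_ext_def indicator_def)
  ultimately show ?thesis by simp
qed

lemma singular_name_unique:
  fixes \<Omega> :: "(real ^ 'n::{finite,linorder}) set"
  assumes dec: "dyadic_encoding dec" and \<Omega>: "\<Omega> \<in> sets lebesgue"
    and fg: "f \<in> L1_funs \<Omega>" "g \<in> L1_funs \<Omega>"
    and f: "is_singular_name pr dec \<Omega> \<phi> f" and g: "is_singular_name pr dec \<Omega> \<phi> g"
  shows "(f, g) \<in> L1_rel \<Omega>"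
proof -
  let ?h = "\<lambda>x. zero_ext \<Omega> f x - zero_ext \<Omega> g x"
  have i: "integrable lebesgue (zero_ext \<Omega> f)" "integrable lebesgue (zero_ext \<Omega> g)"
    using integrable_zero_ext[OF \<Omega>] fg by auto
  have "AE x in lebesgue. ?h x = 0"
  proof (rule integrable_zero_on_dyadic_boxes)
    show "integrable lebesgue ?h" using i by simp
    fix u v :: "real ^ 'n::{finite,linorder}" assume "\<And>i. u $ i \<in> dyadic_rats" "\<And>i. v $ i \<in> dyadic_rats"
    then obtain a b where ab: "encodes_vec pr dec a u" "encodes_vec pr dec b v"
      using ex_encodes_vec[OF dec] by metis
    let ?I = "\<lambda>f. LINT x : corner_box u v | lebesgue. zero_ext \<Omega> f x"
    have "\<bar>?I f - ?I g\<bar> \<le> 2 * (1/2) ^ n" for n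
    proof -
      obtain q where "dec (\<phi> (tuple pr [a, b, unary n])) = Some q" "\<bar>?I f - q\<bar> < 1 / 2 ^ n"
        using f ab unfolding is_singular_name_def by blast
      moreover obtain q' where "dec (\<phi> (tuple pr [a, b, unary n])) = Some q'" "\<bar>?I g - q'\<bar> < 1 / 2 ^ n"
        using g ab unfolding is_singular_name_def by blast
      ultimately have "\<bar>?I f - q\<bar> < 1 / 2 ^ n" "\<bar>?I g - q\<bar> < 1 / 2 ^ n" by auto
      then show ?thesis by (simp add: power_divide)
    qed
    moreover have "(\<lambda>n. 2 * (1/2::real) ^ n) \<longlonglongrightarrow> 0"
      by (intro tendsto_mult_right_zero LIMSEQ_power_zero) simp
    ultimately have "\<bar>?I f - ?I g\<bar> \<le> 0"
      by (intro tendsto_lowerbound[of "\<lambda>n. 2 * (1/2::real) ^ n" 0 sequentially])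
         (blast intro: always_eventually, simp_all)
    moreover have "set_integrable lebesgue (corner_box u v) (zero_ext \<Omega> f)"
      "set_integrable lebesgue (corner_box u v) (zero_ext \<Omega> g)"
      unfolding set_integrable_def corner_box_def using i by (intro integrable_mult_indicator; simp)+
    ultimately show "(LINT x : corner_box u v | lebesgue. ?h x) = 0"
      by (simp add: set_integral_diff(2))
  qed
  then have "AE x in lebesgue_on \<Omega>. f x = g x"
    using \<Omega> by (subst AE_restrict_space_iff) (auto elim!: eventually_mono simp: zero_ext_def)
  then show ?thesis using fg by (simp add: L1_rel_def)
qed

lemma ex1_singular_named:
  assumes "dyadic_encoding dec" "\<Omega> \<in> sets lebesgue" "\<phi> \<in> xi_s_dom pr dec \<Omega>"
  shows "\<exists>!F. F \<in> L1 \<Omega> \<and> (\<exists>f\<in>F. is_singular_name pr dec \<Omega> \<phi> f)"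
proof (rule ex_ex1I)
  show "\<exists>F. F \<in> L1 \<Omega> \<and> (\<exists>f\<in>F. is_singular_name pr dec \<Omega> \<phi> f)"
    using assms(3) by (auto simp: xi_s_dom_def)
  fix F G
  assume "F \<in> L1 \<Omega> \<and> (\<exists>f\<in>F. is_singular_name pr dec \<Omega> \<phi> f)"
    and "G \<in> L1 \<Omega> \<and> (\<exists>f\<in>G. is_singular_name pr dec \<Omega> \<phi> f)"
  then obtain f g where F: "F \<in> L1 \<Omega>" "f \<in> F" "is_singular_name pr dec \<Omega> \<phi> f"
    and G: "G \<in> L1 \<Omega>" "g \<in> G" "is_singular_name pr dec \<Omega> \<phi> g" by blast
  have "f \<in> L1_funs \<Omega>" "g \<in> L1_funs \<Omega>"
    using F G in_quotient_imp_subset[OF equiv_L1_rel] unfolding L1_def by blast+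
  then have "(f, g) \<in> L1_rel \<Omega>" using singular_name_unique assms F G by blast
  then show "F = G"
    using quotient_eq_iff[OF equiv_L1_rel] F G unfolding L1_def by blast
qed

lemma xi_s_in_L1:
  assumes "dyadic_encoding dec" "\<Omega> \<in> sets lebesgue" "\<phi> \<in> xi_s_dom pr dec \<Omega>"
  shows "xi_s pr dec \<Omega> \<phi> \<in> L1 \<Omega>"
  using theI'[OF ex1_singular_named[OF assms]] unfolding xi_s_def by blast

end

theory Submission
  imports Defs
begin

text \<open>On a box \<open>B\<close> inside \<open>\<Omega>\<close> let \<open>f\<^sub>k\<close> be a square wave of values \<open>\<plusminus>1\<close> in one coordinate, with period
  tending to zero. All integrals of \<open>f\<^sub>k\<close> over boxes tend to zero, and the marginals are bounded uniformly
  in \<open>k\<close>, so one modulus serves all \<open>f\<^sub>k\<close>. Hence \<open>f\<^sub>k\<close> has a name that agrees with a fixed name of the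
  zero function wherever zero is a good enough approximation; these names converge to that of zero,
  whereas the norm of \<open>f\<^sub>k\<close> is the volume of \<open>B\<close> for every \<open>k\<close>.\<close>

text \<open>The integral of a non-integrable function is 0 by convention, and \<open>g\<close> is
  nonnegative because it dominates an absolute value. So marginals and their integrals can be
  estimated without measurability proofs for slices.\<close>

lemma abs_integral_le_integral:
  fixes f g :: "'a \<Rightarrow> real"
  assumes g: "integrable M g" and le: "\<And>x. x \<in> space M \<Longrightarrow> \<bar>f x\<bar> \<le> g x"
  shows "\<bar>integral\<^sup>L M f\<bar> \<le> integral\<^sup>L M g"
proof (cases "integrable M f")
  case True
  have "\<bar>integral\<^sup>L M f\<bar> \<le> (LINT x | M. \<bar>f x\<bar>)" by (rule integral_abs_bound)
  also have "\<dots> \<le> integral\<^sup>L M g" using True g le by (intro integral_mono) auto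
  finally show ?thesis .
next
  case False
  have "0 \<le> g x" if "x \<in> space M" for x using le[OF that] by linarith
  then have "0 \<le> integral\<^sup>L M g" by (rule Bochner_Integration.integral_nonneg)
  then show ?thesis using False by (simp add: not_integrable_integral_eq)
qed

section \<open>Unique decoding, and codes of prescribed length\<close>

text \<open>Peeling off one pairing at a time recovers the entries. The lengths have to agree
  because a one-element tuple is its entry, which may itself be the code of a pair.\<close>

lemma tuple_inject:
  assumes pr: "\<And>a b a' b'. pr a b = pr a' b' \<Longrightarrow> a = a' \<and> b = b'"
    and "length xs = length ys" "tuple pr xs = tuple pr ys"
  shows "xs = ys"
  using assms
proof (induction pr xs arbitrary: ys rule: tuple.induct)
  case (1 pr)
  then show ?case by simp
next
  case (2 pr x)
  then obtain y where "ys = [y]" by (metis One_nat_def length_0_conv length_Suc_conv)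
  then show ?case using 2(3) by simp
next
  case (3 pr x x' xs)
  obtain y y' ys' where ys: "ys = y # y' # ys'"
    using 3(3) by (cases ys; cases "tl ys") auto
  have xy: "x = y \<and> tuple pr (x' # xs) = tuple pr (y' # ys')"
    using 3(4) by (intro 3(2)) (simp add: ys)
  have "x' # xs = y' # ys'"
  proof (rule 3(1))
    show "pr a b = pr a' b' \<Longrightarrow> a = a' \<and> b = b'" for a b a' b' by (rule 3(2))
    show "length (x' # xs) = length (y' # ys')" using 3(3) by (simp add: ys)
  qed (use xy in simp)
  then show ?case using xy ys by simp
qed

lemma encodes_vec_unique:
  fixes u v :: "real ^ 'n::{finite,linorder}"
  assumes pr: "\<And>a b a' b'. pr a b = pr a' b' \<Longrightarrow> a = a' \<and> b = b'"
    and u: "encodes_vec pr dec a u" and v: "encodes_vec pr dec a v"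
  shows "u = v"
proof -
  let ?l = "sorted_list_of_set (UNIV :: 'n set)"
  obtain c where c: "a = tuple pr (map c ?l)" "\<And>i. dec (c i) = Some (u $ i)"
    using u unfolding encodes_vec_def by blast
  obtain c' where c': "a = tuple pr (map c' ?l)" "\<And>i. dec (c' i) = Some (v $ i)"
    using v unfolding encodes_vec_def by blast
  have "map c ?l = map c' ?l"
    using c(1) c'(1) by (intro tuple_inject[OF pr]) auto
  then have "c i = c' i" for i by simp
  then show ?thesis using c(2) c'(2) by (metis option.inject vec_eq_iff)
qed

text \<open>The values of a length-monotone function on strings of equal length have equal length, so the
  length of the codes must be fixed before the numbers that they approximate are known.\<close>

lemma exists_common_code_length:
  fixes N :: "bstring \<Rightarrow> nat"
  assumes dec: "dyadic_encoding dec"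
  obtains L :: "nat \<Rightarrow> nat" where "mono L" "\<And>m. m + c \<le> L m"
    "\<And>s r. \<bar>r\<bar> \<le> K \<Longrightarrow>
       \<exists>w q. length w = L (length s) \<and> dec w = Some q \<and> \<bar>r - q\<bar> < 1 / 2 ^ N s"
    "\<And>m. \<exists>w. length w = L m \<and> dec w = Some 0"
proof -
  \<comment> \<open>Answers sufficient for all strings of length \<open>m\<close>: 0 together with,
    for each \<open>s\<close>, the grid of mesh \<open>1 / 2 ^ N s\<close> to which
    \<open>[-K, K]\<close> is rounded down. There are finitely many such strings, hence
    \<open>dyadic_encoding\<close> supplies one code length for all of \<open>Q m\<close>.\<close>
  define Q :: "nat \<Rightarrow> real set" where
    "Q m = insert 0 (\<Union>s\<in>{s. length s = m}. (\<lambda>j. of_int j / 2 ^ N s) ` {\<lfloor>- K * 2 ^ N s\<rfloor>..\<lfloor>K * 2 ^ N s\<rfloor>})" for m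
  have "finite {s :: bstring. length s = m}" for m
    using finite_lists_length_eq[of "UNIV :: bool set" m] by simp
  then have fin: "finite (Q m)" for m unfolding Q_def by (intro finite.insertI finite_UN_I) auto
  have "0 = real_of_int 0 / 2 ^ 0" by simp
  then have "0 \<in> dyadic_rats" unfolding dyadic_rats_def by blast
  then have dy: "Q m \<subseteq> dyadic_rats" for m by (auto simp: Q_def dyadic_rats_def)
  have code: "\<exists>n. M \<le> n \<and> (\<forall>q\<in>Q m. \<exists>a. length a = n \<and> dec a = Some q)" for m M
    using dec[unfolded dyadic_encoding_def, THEN conjunct2, rule_format, OF conjI[OF fin dy]] by simp
  \<comment> \<open>Choosing the lengths one after the other makes them monotone, as length-monotone
    names require; keeping them above \<open>m + c\<close> later makes them a singularity
    modulus.\<close>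
  have "\<exists>L. \<forall>m. (m + c \<le> L m \<and> (\<forall>q\<in>Q m. \<exists>a. length a = L m \<and> dec a = Some q)) \<and> L m \<le> L (Suc m)"
  proof (rule dependent_nat_choice)
    show "\<exists>n. 0 + c \<le> n \<and> (\<forall>q\<in>Q 0. \<exists>a. length a = n \<and> dec a = Some q)" by (rule code)
    show "\<exists>n'. (Suc m + c \<le> n' \<and> (\<forall>q\<in>Q (Suc m). \<exists>a. length a = n' \<and> dec a = Some q)) \<and> n \<le> n'"
      for n m
      using code[of "max (Suc m + c) n" "Suc m"] by auto
  qed
  then obtain L where L: "\<And>m. m + c \<le> L m" "\<And>m q. q \<in> Q m \<Longrightarrow> \<exists>a. length a = L m \<and> dec a = Some q"
    "\<And>m. L m \<le> L (Suc m)" by blast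
  show ?thesis
  proof
    show "mono L" using L(3) by (simp add: mono_iff_le_Suc)
    show "m + c \<le> L m" for m by (rule L(1))
    show "\<exists>w. length w = L m \<and> dec w = Some 0" for m by (rule L(2)) (simp add: Q_def)
    fix s :: bstring and r :: real assume r: "\<bar>r\<bar> \<le> K"
    \<comment> \<open>Rounding down leaves a fractional part below 1, so the error stays strictly
      below the tolerance.\<close>
    let ?j = "\<lfloor>r * 2 ^ N s\<rfloor>"
    have "- K * 2 ^ N s \<le> r * 2 ^ N s" "r * 2 ^ N s \<le> K * 2 ^ N s"
      using r by (intro mult_right_mono; simp add: abs_le_iff)+
    then have "?j \<in> {\<lfloor>- K * 2 ^ N s\<rfloor>..\<lfloor>K * 2 ^ N s\<rfloor>}"
      by (simp only: atLeastAtMost_iff floor_mono)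
    then have "of_int ?j / 2 ^ N s \<in> Q (length s)"
      unfolding Q_def by (intro insertI2 UN_I[of s] imageI) auto
    moreover have "\<bar>r - of_int ?j / 2 ^ N s\<bar> < 1 / 2 ^ N s"
    proof -
      have "r - of_int ?j / 2 ^ N s = frac (r * 2 ^ N s) / 2 ^ N s"
        by (simp add: frac_def field_simps)
      then show ?thesis by (simp add: frac_lt_1 divide_strict_right_mono)
    qed
    ultimately show "\<exists>w q. length w = L (length s) \<and> dec w = Some q \<and> \<bar>r - q\<bar> < 1 / 2 ^ N s"
      using L(2) by blast
  qed
qed

section \<open>Marginals and singularity moduli\<close>

text \<open>A slice of the box orthogonal to axis \<open>i\<close> lies in a product of intervals
  \<open>S i\<close>, whose finite measure depends neither on \<open>t\<close> nor on
  \<open>f\<close>. This uniformity lets one modulus serve all functions dominated by the same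
  box.\<close>

lemma marginal_bound:
  fixes a b :: "real ^ 'n"
  obtains C where "0 \<le> C"
    "\<And>\<Omega> f i t. (\<And>x. \<bar>zero_ext \<Omega> f x\<bar> \<le> indicator (cbox a b) x) \<Longrightarrow> \<bar>marginal \<Omega> f i t\<bar> \<le> C"
proof -
  define M where "M i = completion (Pi\<^sub>M (UNIV - {i}) (\<lambda>_. lborel :: real measure))" for i :: 'n
  define S where "S i = (\<Pi>\<^sub>E j\<in>UNIV - {i}. {a $ j..b $ j})" for i
  have S: "S i \<in> sets (M i)" "emeasure (M i) (S i) < \<infinity>" for i
  proof -
    interpret product_sigma_finite "\<lambda>_::'n. lborel :: real measure" by standard
    have *: "S i \<in> sets (Pi\<^sub>M (UNIV - {i}) (\<lambda>_. lborel))"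
      unfolding S_def by (intro sets_PiM_I_finite) auto
    then show "S i \<in> sets (M i)" unfolding M_def by simp
    have "emeasure (M i) (S i) = (\<Prod>j\<in>UNIV - {i}. emeasure lborel {a $ j..b $ j})"
      unfolding M_def using * by (simp add: S_def emeasure_PiM)
    also have "\<dots> < \<infinity>"
      by (simp add: less_top[symmetric] ennreal_prod_eq_top emeasure_lborel_Icc_eq)
    finally show "emeasure (M i) (S i) < \<infinity>" .
  qed
  have bound: "\<bar>marginal \<Omega> f i t\<bar> \<le> measure (M i) (S i)"
    if f: "\<And>x. \<bar>zero_ext \<Omega> f x\<bar> \<le> indicator (cbox a b) x" for \<Omega> f i t
  proof -
    have "\<bar>marginal \<Omega> f i t\<bar> \<le> (LINT y | M i. indicator (S i) y)"
      unfolding marginal_def M_def[symmetric]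
    proof (rule abs_integral_le_integral)
      show "integrable (M i) (indicator (S i) :: _ \<Rightarrow> real)"
        using S by (simp add: integrable_indicator_iff)
      fix y assume y: "y \<in> space (M i)"
      let ?x = "\<chi> j. if j = i then t else y j"
      have "indicator (cbox a b) ?x \<le> (indicator (S i) y :: real)"
        using y by (auto simp: indicator_def S_def M_def mem_box_cart space_PiM PiE_iff split: if_splits)
      then show "\<bar>zero_ext \<Omega> f ?x\<bar> \<le> indicator (S i) y" using f[of ?x] by linarith
    qed
    then show ?thesis using S(1) by simp
  qed
  have le: "measure (M i) (S i) \<le> (\<Sum>i\<in>UNIV. measure (M i) (S i))" for i
    by (rule member_le_sum) auto
  show ?thesis
    by (rule that[of "\<Sum>i\<in>UNIV. measure (M i) (S i)"]) (auto intro: sum_nonneg order_trans[OF bound le])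
qed

text \<open>The integral of a marginal over an interval is at most \<open>C\<close> times its
  length. The shift \<open>c\<close> in the modulus absorbs this factor, and
  \<open>C < 2 ^ c\<close> yields the strict inequality.\<close>

lemma singularity_modulus_of_bounded_marginals:
  assumes C: "\<And>i t. \<bar>marginal \<Omega> f i t\<bar> \<le> C" and "C < 2 ^ c" and \<mu>: "\<And>n. n + c \<le> \<mu> n"
  shows "singularity_modulus \<Omega> f \<mu>"
  unfolding singularity_modulus_def
proof (intro allI impI)
  fix i n and x y :: real assume xy: "\<bar>x - y\<bar> \<le> 1 / 2 ^ \<mu> n"
  have C0: "0 \<le> C" using C[of i 0] by linarith
  let ?I = "{min x y..max x y}"
  have "\<bar>LINT t : ?I | lebesgue. marginal \<Omega> f i t\<bar> \<le> (LINT t | lebesgue. C * indicator ?I t)"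
    unfolding set_lebesgue_integral_def
  proof (rule abs_integral_le_integral)
    show "integrable lebesgue (\<lambda>t. C * indicator ?I t)"
      by (intro integrable_mult_right) (simp add: integrable_indicator_iff)
    show "\<bar>indicator ?I t *\<^sub>R marginal \<Omega> f i t\<bar> \<le> C * indicator ?I t" for t
      using C by (auto simp: indicator_def)
  qed
  also have "\<dots> = C * \<bar>x - y\<bar>" by (simp add: min_def max_def)
  also have "\<dots> \<le> C * (1 / 2 ^ (n + c))"
    using xy order_trans[OF xy, of "1 / 2 ^ (n + c)"] \<mu>[of n] C0
    by (intro mult_left_mono) (auto simp: divide_simps)
  also have "\<dots> < 1 / 2 ^ n"
    using \<open>C < 2 ^ c\<close> by (simp add: power_add field_simps)
  finally show "\<bar>LINT t : ?I | lebesgue. marginal \<Omega> f i t\<bar> < 1 / 2 ^ n" .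
qed

section \<open>Square waves and their box integrals\<close>

text \<open>Half-open dyadic cells make the sign change under a shift by half a period exact, with
  no exceptional points at the jumps.\<close>

definition square_wave :: "nat \<Rightarrow> real \<Rightarrow> real" where
  "square_wave k t = (if even \<lfloor>2 ^ k * t\<rfloor> then 1 else - 1)"

lemma abs_square_wave [simp]: "\<bar>square_wave k t\<bar> = 1"
  by (simp add: square_wave_def)

lemma square_wave_shift: "square_wave k (1 / 2 ^ k + t) = - square_wave k t"
proof -
  have "2 ^ k * (1 / 2 ^ k + t) = 2 ^ k * t + 1" by (simp add: field_simps)
  then show ?thesis by (simp add: square_wave_def)
qed

lemma square_wave_measurable [measurable]: "square_wave k \<in> borel_measurable borel"
proof -
  have "(\<lambda>t::real. \<lfloor>2 ^ k * t\<rfloor>) \<in> borel \<rightarrow>\<^sub>M count_space UNIV" for k :: nat by measurable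
  then show ?thesis unfolding square_wave_def by measurable
qed

text \<open>Translating by half a period flips the sign of the wave, so twice the integral over a box
  is the integral over the difference between the box and its translate.\<close>

lemma square_wave_box_integral_tendsto_0:
  fixes a b :: "real ^ 'n"
  shows "(\<lambda>k. LINT x : cbox a b | lborel. square_wave k (x $ i)) \<longlonglongrightarrow> 0"
proof -
  define e where "e k = axis i (1 / 2 ^ k :: real)" for k :: nat
  let ?D = "\<lambda>k x. \<bar>indicator (cbox a b) x - indicator (cbox a b) (e k + x)\<bar> :: real"
  let ?I = "\<lambda>k. LINT x : cbox a b | lborel. square_wave k (x $ i)"
  have e0: "e \<longlonglongrightarrow> 0"
  proof (rule tendsto_vec_lambda[THEN tendsto_eq_rhs, of "\<lambda>k j. e k $ j" "\<lambda>_. 0", simplified])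
    show "(\<lambda>k. e k $ j) \<longlonglongrightarrow> 0" for j
      using LIMSEQ_divide_realpow_zero[of 2 1] by (cases "j = i") (auto simp: e_def axis_def)
  qed (simp add: vec_eq_iff)
  have int: "integrable lborel (indicator (cbox l u) :: real ^ 'n \<Rightarrow> real)" for l u
    by (simp add: integrable_indicator_iff emeasure_lborel_cbox_eq)
  have shift: "integrable lborel (\<lambda>x. g (c + x))" "(LINT x | lborel. g (c + x)) = (LINT x | lborel. g x)"
    if "integrable lborel g" for g :: "real ^ 'n \<Rightarrow> real" and c
  proof -
    have "integrable (distr lborel borel ((+) c)) g" unfolding lborel_distr_plus by fact
    then show "integrable lborel (\<lambda>x. g (c + x))" using that by (subst (asm) integrable_distr_eq) auto
    have "(LINT x | lborel. g x) = (LINT x | distr lborel borel ((+) c). g x)" unfolding lborel_distr_plus ..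
    also have "\<dots> = (LINT x | lborel. g (c + x))" using that by (subst integral_distr) auto
    finally show "(LINT x | lborel. g (c + x)) = (LINT x | lborel. g x)" by simp
  qed
  have iw: "integrable lborel (\<lambda>x. indicator (cbox a b) (c + x) * square_wave k (x $ i))" for c k
    by (rule Bochner_Integration.integrable_bound[OF shift(1)[OF int[of a b], of c]]) (auto simp: abs_mult)
  have bound: "2 * \<bar>?I k\<bar> \<le> (LINT x | lborel. ?D k x)" for k
  proof -
    have "?I k = (LINT x | lborel. indicator (cbox a b) x * square_wave k (x $ i))"
      by (simp add: set_lebesgue_integral_def)
    moreover have "\<dots> = (LINT x | lborel. indicator (cbox a b) (e k + x) * square_wave k ((e k + x) $ i))"
      using iw[of 0] by (subst shift(2)) auto
    moreover have "square_wave k ((e k + x) $ i) = - square_wave k (x $ i)" for x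
      by (simp add: e_def square_wave_shift)
    ultimately have "2 * ?I k = (LINT x | lborel. indicator (cbox a b) x * square_wave k (x $ i))
        - (LINT x | lborel. indicator (cbox a b) (e k + x) * square_wave k (x $ i))"
      by simp
    also have "\<dots> = (LINT x | lborel. (indicator (cbox a b) x - indicator (cbox a b) (e k + x)) * square_wave k (x $ i))"
      using iw[of 0] iw[of "e k"] by (simp add: left_diff_distrib)
    finally have "\<bar>2 * ?I k\<bar> \<le> (LINT x | lborel. ?D k x)"
      using int shift(1)[OF int, of a b "e k"]
      by (simp only:) (rule abs_integral_le_integral, auto simp: abs_mult)
    then show ?thesis by simp
  qed
  have "(\<lambda>k. LINT x | lborel. ?D k x) \<longlonglongrightarrow> (LINT x::real ^ 'n | lborel. (0::real))"
  proof (rule integral_dominated_convergence[where w="indicator (cbox (a - 1) b) :: _ \<Rightarrow> real"])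
    \<comment> \<open>Lowering the lower corner by 1 in each coordinate covers the box and all its
      translates by \<open>- e k\<close>, since the entries of \<open>e k\<close> lie in
      \<open>[0, 1]\<close>.\<close>
    show "AE x in lborel. norm (?D k x) \<le> indicator (cbox (a - 1) b) x" for k
    proof (rule AE_I2)
      fix x
      have "x \<in> cbox (a - 1) b" if "x \<in> cbox a b \<or> e k + x \<in> cbox a b"
      proof -
        have "0 \<le> e k $ j \<and> e k $ j \<le> 1" for j by (auto simp: e_def axis_def)
        then have "a $ j - 1 \<le> x $ j \<and> x $ j \<le> b $ j" for j
          using that by (smt (verit) mem_box_cart vector_add_component)
        then show ?thesis by (simp add: mem_box_cart)
      qed
      then show "norm (?D k x) \<le> indicator (cbox (a - 1) b) x" by (auto simp: indicator_def)
    qed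
    \<comment> \<open>Pointwise convergence can fail only on the frontier, which is null. Elsewhere
      \<open>x\<close> and \<open>e k + x\<close> eventually lie both in the box or both outside, so
      \<open>?D k x\<close> is eventually 0.\<close>
    have "negligible (frontier (cbox a b))" by (intro negligible_convex_frontier convex_box)
    then have "AE x in lborel. x \<notin> frontier (cbox a b)"
      by (intro AE_not_in) (simp add: negligible_iff_null_sets null_sets_def)
    then show "AE x in lborel. (\<lambda>k. ?D k x) \<longlonglongrightarrow> 0"
    proof (rule eventually_mono)
      fix x assume x: "x \<notin> frontier (cbox a b)"
      have lim: "(\<lambda>k. e k + x) \<longlonglongrightarrow> x" using tendsto_add[OF e0 tendsto_const[of x]] by simp
      consider "x \<in> interior (cbox a b)" | "x \<in> - cbox a b"
        using x by (auto simp: frontier_def)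
      then have "\<forall>\<^sub>F k in sequentially. ?D k x = 0"
      proof cases
        case 1
        have "\<forall>\<^sub>F k in sequentially. e k + x \<in> interior (cbox a b)"
          by (rule topological_tendstoD[OF lim open_interior 1])
        then show ?thesis using 1 box_subset_cbox[of a b] by (auto elim!: eventually_mono simp: indicator_def)
      next
        case 2
        have "\<forall>\<^sub>F k in sequentially. e k + x \<in> - cbox a b"
          by (rule topological_tendstoD[OF lim _ 2]) (intro open_Compl closed_cbox)
        then show ?thesis using 2 by (auto elim!: eventually_mono simp: indicator_def)
      qed
      then show "(\<lambda>k. ?D k x) \<longlonglongrightarrow> 0" by (rule tendsto_eventually)
    qed
  qed (auto intro: int)
  then have "(\<lambda>k. LINT x | lborel. ?D k x) \<longlonglongrightarrow> 0" by simp
  then show ?thesis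
    by (rule Lim_null_comparison[rotated]) (use bound in \<open>auto intro!: always_eventually order_trans[OF _ bound]\<close>)
qed

section \<open>Names that prefer the code of zero\<close>

text \<open>A query string asks for one box integral at one precision. Once this integral is within
  tolerance of 0, the name of \<open>f k\<close> gives the very answer given for 0. Exact agreement
  is the aim, since strings carry the discrete topology.\<close>

lemma exists_singular_names:
  fixes \<Omega> :: "(real ^ 'n::{finite,linorder}) set" and a b :: "(real, 'n) vec"
  assumes bij: "bij (\<lambda>(a, b). pr a b)" and dec: "dyadic_encoding dec"
  obtains name :: "((real, 'n) vec \<Rightarrow> real) \<Rightarrow> bstring \<Rightarrow> bstring" where
    "\<And>f. (\<And>x. \<bar>f x\<bar> \<le> indicator (cbox a b) x) \<Longrightarrow> is_singular_name pr dec \<Omega> (name f) f"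
    "\<And>f s. (\<And>u v. (\<lambda>k. LINT x : corner_box u v | lebesgue. zero_ext \<Omega> (f k) x) \<longlonglongrightarrow> 0) \<Longrightarrow>
       \<forall>\<^sub>F k in sequentially. name (f k) s = name (\<lambda>_. 0) s"
proof -
  define P where "P = (\<lambda>(a, b). pr a b)"
  have injP: "inj P" using bij by (simp add: P_def bij_is_inj)
  have pr: "a = a' \<and> b = b'" if "pr a b = pr a' b'" for a b a' b'
    using injD[OF injP, of "(a, b)" "(a', b')"] that by (simp add: P_def)
  \<comment> \<open>Reads the precision \<open>n\<close> off a query
    \<open>tuple pr [a, b, unary n]\<close>, so that code lengths can be fixed before any function
    is given. On other strings the value is arbitrary.\<close>
  define N where "N s = length (snd (inv P (snd (inv P s))))" for s
  have N: "N (tuple pr [a, b, unary n]) = n" for a b n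
  proof -
    have "tuple pr [a, b, unary n] = P (a, P (b, unary n))" by (simp add: P_def)
    then show ?thesis by (simp add: N_def inv_f_f[OF injP] unary_def)
  qed
  define I where "I f u v = (LINT x : corner_box u v | lebesgue. zero_ext \<Omega> f x)"
    for f and u v :: "(real, 'n) vec"
  define K where "K = measure lebesgue (cbox a b)"
  obtain C where C: "0 \<le> C"
    "\<And>f i t. (\<And>x. \<bar>zero_ext \<Omega> f x\<bar> \<le> indicator (cbox a b) x) \<Longrightarrow> \<bar>marginal \<Omega> f i t\<bar> \<le> C"
    by (rule marginal_bound[of a b]) blast
  obtain c where c: "C < 2 ^ c" using real_arch_pow[of 2 C] by auto
  obtain L :: "nat \<Rightarrow> nat" where L: "mono L" "\<And>m. m + c \<le> L m"
    "\<And>s r. \<bar>r\<bar> \<le> K \<Longrightarrow>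
       \<exists>w q. length w = L (length s) \<and> dec w = Some q \<and> \<bar>r - q\<bar> < 1 / 2 ^ N s"
    "\<And>m. \<exists>w. length w = L m \<and> dec w = Some 0"
    using exists_common_code_length[OF dec, of c K N] by blast
  \<comment> \<open>The acceptable answers to \<open>s\<close>; a string that is no query accepts
    every answer.\<close>
  define valid where "valid f s w \<longleftrightarrow> (\<forall>a b u v n. s = tuple pr [a, b, unary n] \<and>
      encodes_vec pr dec a u \<and> encodes_vec pr dec b v \<longrightarrow>
        (\<exists>q. dec w = Some q \<and> \<bar>I f u v - q\<bar> < 1 / 2 ^ n))" for f s w
  \<comment> \<open>A string can be read as a query in only one way; otherwise one answer might have
    to approximate several integrals.\<close>
  have unique: "a = a' \<and> b = b' \<and> u = u' \<and> v = v' \<and> n = n'"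
    if "tuple pr [a, b, unary n] = tuple pr [a', b', unary n']"
      "encodes_vec pr dec a u" "encodes_vec pr dec b v"
      "encodes_vec pr dec a' u'" "encodes_vec pr dec b' v'"
    for a b a' b' n n' and u v u' v' :: "(real, 'n) vec"
  proof -
    have "a = a'" "b = b'" "n = n'"
      using tuple_inject[OF pr _ that(1)] N[of a b n] N[of a' b' n'] that(1) by auto
    then show ?thesis using encodes_vec_unique[OF pr] that(2-5) by blast
  qed
  define z where "z m = (SOME w. length w = L m \<and> dec w = Some 0)" for m
  have z: "length (z m) = L m" "dec (z m) = Some 0" for m
    using someI_ex[OF L(4)[of m]] by (auto simp: z_def)
  \<comment> \<open>The fixed code of 0 takes precedence over all other valid answers of the same
    length; hence names of functions with small box integrals agree with the name of 0.\<close>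
  define name where "name f s = (if valid f s (z (length s)) then z (length s)
     else SOME w. length w = L (length s) \<and> valid f s w)" for f s
  have ex: "\<exists>w. length w = L (length s) \<and> valid f s w"
    if f: "\<And>x. \<bar>f x\<bar> \<le> indicator (cbox a b) x" for f s
  proof (cases "\<exists>a b u v n. s = tuple pr [a, b, unary n] \<and>
      encodes_vec pr dec a (u :: (real, 'n) vec) \<and> encodes_vec pr dec b (v :: (real, 'n) vec)")
    case True
    then obtain a' b' n and u v :: "(real, 'n) vec" where s: "s = tuple pr [a', b', unary n]"
      and uv: "encodes_vec pr dec a' u" "encodes_vec pr dec b' v" by blast
    have "\<bar>I f u v\<bar> \<le> (LINT x | lebesgue. indicator (cbox a b) x)"
      unfolding I_def set_lebesgue_integral_def
    proof (rule abs_integral_le_integral)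
      show "integrable lebesgue (indicator (cbox a b) :: _ \<Rightarrow> real)"
        by (simp add: integrable_indicator_iff emeasure_lborel_cbox_eq)
      show "\<bar>indicator (corner_box u v) x *\<^sub>R zero_ext \<Omega> f x\<bar> \<le> indicator (cbox a b) x" for x
        using f[of x] by (auto simp: indicator_def zero_ext_def split: if_splits)
    qed
    then have "\<bar>I f u v\<bar> \<le> K" by (simp add: K_def)
    then obtain w q where w: "length w = L (length s)" "dec w = Some q" "\<bar>I f u v - q\<bar> < 1 / 2 ^ n"
      using L(3)[of "I f u v" s] N[of a' b' n] unfolding s by auto
    have "valid f s w"
      unfolding valid_def
    proof (intro allI impI, elim conjE)
      fix a'' b'' n' and u' v' :: "(real, 'n) vec"
      assume "s = tuple pr [a'', b'', unary n']" "encodes_vec pr dec a'' u'" "encodes_vec pr dec b'' v'"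
      then have "u = u' \<and> v = v' \<and> n = n'" using unique uv unfolding s by blast
      then show "\<exists>q. dec w = Some q \<and> \<bar>I f u' v' - q\<bar> < 1 / 2 ^ n'" using w by blast
    qed
    then show ?thesis using w(1) by blast
  next
    case False
    then have "valid f s (z (length s))" unfolding valid_def by blast
    then show ?thesis using z(1) by blast
  qed
  have name: "length (name f s) = L (length s) \<and> valid f s (name f s)"
    if "\<And>x. \<bar>f x\<bar> \<le> indicator (cbox a b) x" for f s
    using someI_ex[OF ex[OF that, of s]] z(1) by (simp add: name_def)
  show ?thesis
  proof
    fix f :: "(real, 'n) vec \<Rightarrow> real" assume f: "\<And>x. \<bar>f x\<bar> \<le> indicator (cbox a b) x"
    note nf = name[OF f]
    have "length_monotone (name f)"
      using nf L(1) by (simp add: length_monotone_def monoD)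
    moreover have "singularity_modulus \<Omega> f (fun_size (name f))"
    proof (rule singularity_modulus_of_bounded_marginals)
      have "\<bar>zero_ext \<Omega> f x\<bar> \<le> indicator (cbox a b) x" for x using f[of x] by (auto simp: zero_ext_def)
      then show "\<bar>marginal \<Omega> f i t\<bar> \<le> C" for i t by (rule C(2))
      show "n + c \<le> fun_size (name f) n" for n using nf L(2) by (simp add: fun_size_def unary_def)
    qed (rule c)
    ultimately show "is_singular_name pr dec \<Omega> (name f) f"
      using nf unfolding is_singular_name_def valid_def I_def by blast
  next
    fix f :: "nat \<Rightarrow> (real, 'n) vec \<Rightarrow> real" and s
    assume lim: "\<And>u v. (\<lambda>k. LINT x : corner_box u v | lebesgue. zero_ext \<Omega> (f k) x) \<longlonglongrightarrow> 0"
    have "I (\<lambda>_. 0) u v = 0" for u v by (simp add: I_def zero_ext_def set_lebesgue_integral_def)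
    then have "valid (\<lambda>_. 0) s (z (length s))" by (simp add: valid_def z)
    then have z0: "name (\<lambda>_. 0) s = z (length s)" by (simp add: name_def)
    \<comment> \<open>The query fixes the box and the precision, so convergence for each single box
      suffices.\<close>
    have "\<forall>\<^sub>F k in sequentially. valid (f k) s (z (length s))"
    proof (cases "\<exists>a b u v n. s = tuple pr [a, b, unary n] \<and>
        encodes_vec pr dec a (u :: (real, 'n) vec) \<and> encodes_vec pr dec b (v :: (real, 'n) vec)")
      case True
      then obtain a' b' n and u v :: "(real, 'n) vec" where s: "s = tuple pr [a', b', unary n]"
        and uv: "encodes_vec pr dec a' u" "encodes_vec pr dec b' v" by blast
      have "\<forall>\<^sub>F k in sequentially. \<bar>I (f k) u v\<bar> < 1 / 2 ^ n"
        using tendstoD[OF lim[of u v], of "1 / 2 ^ n"] by (simp add: I_def)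
      then show ?thesis
      proof (rule eventually_mono)
        fix k assume k: "\<bar>I (f k) u v\<bar> < 1 / 2 ^ n"
        show "valid (f k) s (z (length s))"
          unfolding valid_def
        proof (intro allI impI, elim conjE)
          fix a'' b'' n' and u' v' :: "(real, 'n) vec"
          assume "s = tuple pr [a'', b'', unary n']" "encodes_vec pr dec a'' u'" "encodes_vec pr dec b'' v'"
          then have "u = u' \<and> v = v' \<and> n = n'" using unique uv unfolding s by blast
          then show "\<exists>q. dec (z (length s)) = Some q \<and> \<bar>I (f k) u' v' - q\<bar> < 1 / 2 ^ n'"
            using k z(2) by auto
        qed
      qed
    next
      case False
      then have "valid (f k) s (z (length s))" for k unfolding valid_def by blast
      then show ?thesis by simp
    qed
    then show "\<forall>\<^sub>F k in sequentially. name (f k) s = name (\<lambda>_. 0) s"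
      unfolding z0 by (rule eventually_mono) (simp add: name_def)
  qed
qed

section \<open>Classes of integrable functions and convergence in Baire space\<close>

lemma L1_class: "f \<in> L1_funs \<Omega> \<Longrightarrow> L1_rel \<Omega> `` {f} \<in> L1 \<Omega>" "f \<in> L1_funs \<Omega> \<Longrightarrow> f \<in> L1_rel \<Omega> `` {f}"
  unfolding L1_def using equiv_class_self[OF equiv_L1_rel] by (auto intro: quotientI)

text \<open>The distance is computed on representatives picked by choice; these differ from
  \<open>f\<close> and \<open>g\<close> only on null sets.\<close>

lemma L1_dist_classes:
  assumes f: "f \<in> L1_funs \<Omega>" and g: "g \<in> L1_funs \<Omega>"
  shows "L1_dist \<Omega> (L1_rel \<Omega> `` {f}) (L1_rel \<Omega> `` {g}) = (LINT x | lebesgue_on \<Omega>. \<bar>f x - g x\<bar>)"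
proof -
  let ?f = "SOME h. h \<in> L1_rel \<Omega> `` {f}" and ?g = "SOME h. h \<in> L1_rel \<Omega> `` {g}"
  have f': "(f, ?f) \<in> L1_rel \<Omega>" and g': "(g, ?g) \<in> L1_rel \<Omega>"
    using L1_rep(1)[OF L1_class(1)[OF f]] L1_rep(1)[OF L1_class(1)[OF g]] by auto
  then have m: "f \<in> borel_measurable (lebesgue_on \<Omega>)" "?f \<in> borel_measurable (lebesgue_on \<Omega>)"
    "g \<in> borel_measurable (lebesgue_on \<Omega>)" "?g \<in> borel_measurable (lebesgue_on \<Omega>)"
    by (auto simp: L1_rel_def L1_funs_def)
  have "AE x in lebesgue_on \<Omega>. f x = ?f x" "AE x in lebesgue_on \<Omega>. g x = ?g x"
    using f' g' by (auto simp: L1_rel_def)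
  then have ae: "AE x in lebesgue_on \<Omega>. \<bar>?f x - ?g x\<bar> = \<bar>f x - g x\<bar>"
    by (rule eventually_elim2) simp
  show ?thesis
    unfolding L1_dist_def by (rule integral_cong_AE[OF _ _ ae]) (use m in measurable)
qed

lemma xi_s_name:
  assumes "dyadic_encoding dec" "\<Omega> \<in> sets lebesgue" "f \<in> L1_funs \<Omega>" "is_singular_name pr dec \<Omega> \<phi> f"
  shows "\<phi> \<in> xi_s_dom pr dec \<Omega>" "xi_s pr dec \<Omega> \<phi> = L1_rel \<Omega> `` {f}"
proof -
  have F: "L1_rel \<Omega> `` {f} \<in> L1 \<Omega> \<and> (\<exists>f\<in>L1_rel \<Omega> `` {f}. is_singular_name pr dec \<Omega> \<phi> f)"
    using L1_class[OF assms(3)] assms(4) by blast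
  then show *: "\<phi> \<in> xi_s_dom pr dec \<Omega>" unfolding xi_s_dom_def by blast
  show "xi_s pr dec \<Omega> \<phi> = L1_rel \<Omega> `` {f}"
    unfolding xi_s_def by (rule the1_equality[OF ex1_singular_named[OF assms(1,2) *] F])
qed

text \<open>Convergence in a product is componentwise, and singletons are open in a discrete space,
  so each component eventually equals its limit.\<close>

lemma limitin_baire_space:
  "limitin baire_space \<psi> \<phi> F \<longleftrightarrow> (\<forall>s. \<forall>\<^sub>F k in F. \<psi> k s = \<phi> s)"
proof -
  have discrete: "limitin (discrete_topology UNIV) h l F \<longleftrightarrow> (\<forall>\<^sub>F k in F. h k = l)"
    for h :: "_ \<Rightarrow> bstring" and l
  proof
    assume "limitin (discrete_topology UNIV) h l F"
    then show "\<forall>\<^sub>F k in F. h k = l" unfolding limitin_def by (auto dest: spec[of _ "{l}"])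
  next
    assume "\<forall>\<^sub>F k in F. h k = l"
    then show "limitin (discrete_topology UNIV) h l F"
      unfolding limitin_def by (auto elim: eventually_mono)
  qed
  show ?thesis unfolding baire_space_def limitin_componentwise discrete by simp
qed

section \<open>Discontinuity at a name of the zero function\<close>

theorem theorem2p10:
  fixes \<Omega> :: "(real ^ 'n::{finite,linorder}) set"
    and pr :: "bstring \<Rightarrow> bstring \<Rightarrow> bstring"
    and dec :: "bstring \<rightharpoonup> real"
  assumes "bij (\<lambda>(a, b). pr a b)"
    and "dyadic_encoding dec"
    and "\<Omega> \<in> sets lebesgue"
    and "bounded \<Omega>"
    and "interior \<Omega> \<noteq> {}"
  shows "\<not> continuous_map (subtopology baire_space (xi_s_dom pr dec \<Omega>))
             (L1_topology \<Omega>) (xi_s pr dec \<Omega>)"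
proof
  assume cont: "continuous_map (subtopology baire_space (xi_s_dom pr dec \<Omega>))
             (L1_topology \<Omega>) (xi_s pr dec \<Omega>)"
  interpret L1: Metric_space "L1 \<Omega>" "L1_dist \<Omega>" by (rule Metric_space_L1)
  obtain x0 where "x0 \<in> interior \<Omega>" using assms(5) by blast
  \<comment> \<open>Strict inequalities between the corners give the box positive volume.\<close>
  then obtain a b where ab: "cbox a b \<subseteq> interior \<Omega>" "\<forall>i\<in>Basis. a \<bullet> i < b \<bullet> i"
    using open_contains_cbox[OF open_interior] by metis
  have sub: "cbox a b \<subseteq> \<Omega>" using ab(1) interior_subset by blast
  have pos: "0 < measure lebesgue (cbox a b)"
    using ab(2) by (simp add: content_pos_lt)
  \<comment> \<open>Any coordinate will do as the direction of oscillation.\<close>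
  define i :: 'n where "i = undefined"
  define f where "f k x = indicator (cbox a b) x * square_wave k (x $ i)" for k and x :: "(real, 'n) vec"
  have meas [measurable]: "f k \<in> borel_measurable borel" for k
    unfolding f_def by measurable
  have abs_f: "\<bar>f k x\<bar> = indicator (cbox a b) x" for k x by (simp add: f_def abs_mult)
  have int: "integrable (lebesgue_on \<Omega>) (indicator (cbox a b) :: _ \<Rightarrow> real)"
    using assms(3) sub
    by (subst integrable_restrict_space)
       (auto simp: integrable_indicator_iff emeasure_lborel_cbox_eq indicator_inter_arith[symmetric] Int_absorb1)
  have fL1: "f k \<in> L1_funs \<Omega>" for k
    unfolding L1_funs_def mem_Collect_eq
    by (rule Bochner_Integration.integrable_bound[OF int])
       (auto simp: abs_f intro!: measurable_restrict_space1 measurable_completion)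
  have zL1: "(\<lambda>_. 0) \<in> L1_funs \<Omega>" by (simp add: L1_funs_def)
  have zero_f: "zero_ext \<Omega> (f k) = f k" for k
    using sub by (auto simp: zero_ext_def f_def indicator_def fun_eq_iff)
  have lim: "(\<lambda>k. LINT x : corner_box u v | lebesgue. zero_ext \<Omega> (f k) x) \<longlonglongrightarrow> 0" for u v
  proof -
    \<comment> \<open>Two boxes meet in a box, so each query about \<open>f k\<close> reduces to a
      box integral of the bare wave.\<close>
    obtain a' b' where box: "cbox a b \<inter> corner_box u v = cbox a' b'"
      unfolding corner_box_def Int_interval by blast
    have "(LINT x : corner_box u v | lebesgue. zero_ext \<Omega> (f k) x)
        = (LINT x : cbox a' b' | lborel. square_wave k (x $ i))" for k
    proof -
      have "(LINT x : corner_box u v | lebesgue. zero_ext \<Omega> (f k) x)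
          = (LINT x : corner_box u v | lborel. f k x)"
        unfolding set_lebesgue_integral_def zero_f corner_box_def
        by (intro integral_completion) simp
      also have "\<dots> = (LINT x : cbox a' b' | lborel. square_wave k (x $ i))"
        unfolding set_lebesgue_integral_def box[symmetric] f_def
        by (intro Bochner_Integration.integral_cong) (auto simp: indicator_def)
      finally show ?thesis .
    qed
    then show ?thesis using square_wave_box_integral_tendsto_0 by simp
  qed
  obtain name where name: "\<And>f. (\<And>x. \<bar>f x\<bar> \<le> indicator (cbox a b) x) \<Longrightarrow> is_singular_name pr dec \<Omega> (name f) f"
    and ev: "\<And>f s. (\<And>u v. (\<lambda>k. LINT x : corner_box u v | lebesgue. zero_ext \<Omega> (f k) x) \<longlonglongrightarrow> 0) \<Longrightarrow>
       \<forall>\<^sub>F k in sequentially. name (f k) s = name (\<lambda>_. 0) s"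
    using exists_singular_names[OF assms(1,2)] by blast
  have nf: "is_singular_name pr dec \<Omega> (name (f k)) (f k)" for k by (rule name) (simp add: abs_f)
  have nz: "is_singular_name pr dec \<Omega> (name (\<lambda>_. 0)) (\<lambda>_. 0)" by (rule name) simp
  note xf = xi_s_name[OF assms(2,3) fL1 nf] and xz = xi_s_name[OF assms(2,3) zL1 nz]
  \<comment> \<open>Convergence in the subspace also requires the names to lie in the domain, which
    \<open>xf(1)\<close> and \<open>xz(1)\<close> provide.\<close>
  have "limitin (subtopology baire_space (xi_s_dom pr dec \<Omega>)) (\<lambda>k. name (f k)) (name (\<lambda>_. 0)) sequentially"
    using xf(1) xz(1) ev[OF lim] by (simp add: limitin_subtopology limitin_baire_space)
  from continuous_map_limit[OF cont this]
  have "limitin L1.mtopology (\<lambda>k. L1_rel \<Omega> `` {f k}) (L1_rel \<Omega> `` {\<lambda>_. 0}) sequentially"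
    by (simp add: L1_topology_def xf(2) xz(2) o_def)
  then obtain k where "L1_dist \<Omega> (L1_rel \<Omega> `` {f k}) (L1_rel \<Omega> `` {\<lambda>_. 0}) < measure lebesgue (cbox a b)"
    using pos unfolding L1.limit_metric_sequentially by blast
  \<comment> \<open>The absolute value of \<open>f k\<close> is the indicator of the box for every
    \<open>k\<close>, so the distance to 0 does not shrink.\<close>
  moreover have "L1_dist \<Omega> (L1_rel \<Omega> `` {f k}) (L1_rel \<Omega> `` {\<lambda>_. 0}) = measure lebesgue (cbox a b)"
    using assms(3) sub
    by (simp add: L1_dist_classes[OF fL1 zL1] abs_f measure_restrict_space Int_absorb2)
  ultimately show False by simp
qed

end
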